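(* Let $B$ be a Banach space, let $S$ be a nonempty closed convex subset of $B$, and let $T:S\to S$ be a contraction, i.e. there is $\delta\in(0,1)$ with $\|Tx-Ty\|\le\delta\|x-y\|$ for all $x,y\in S$. Let $\{\alpha_n^1\}_{n=0}^\infty,\{\alpha_n^2\}_{n=0}^\infty,\{\alpha_n^3\}_{n=0}^\infty$ be real sequences in $[0,1]$ with $\sum_{k=0}^{\infty}\alpha_k^1=\infty$. Let $p_0\in S$ and let $\{p_n\}_{n=0}^\infty$ be defined, for $n\in\mathbb{N}$, by $$\begin{aligned} r_n&=(1-\alpha_n^3)p_n+\alpha_n^3Tp_n,\\ q_n&=(1-\alpha_n^2)Tp_n+\alpha_n^2Tr_n,\\ p_{n+1}&=(1-\alpha_n^1)Tp_n+\alpha_n^1Tq_n. \end{aligned}$$ Then $T$ has a unique fixed point $x_*\in S$, and $\{p_n\}_{n=0}^\infty$ converges to $x_*$ in norm.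
   Context: $\mathbb{N}$ denotes the set of nonnegative integers (including zero). In the superscripted symbols $\alpha_n^i$ the superscript $i\in\{1,2,3\}$ is an index, not a power. *)

theory Defs
  imports "HOL-Analysis.Analysis"
begin

end

(* For a fixed point x, convexity gives |r_n - x| <= |p_n - x|, then |q_n - x| <= \<delta> |p_n - x|,
   and p_(n+1) is a convex combination of T p_n and T q_n, both within \<delta> |p_n - x| of x.
   Hence |p_n - x| <= \<delta>^n |p_0 - x|. *)
theory Submission
  imports Defs
begin

text \<open>The closed ball of radius \<open>c\<close> around \<open>x\<close> is convex.\<close>

lemma norm_convex_combination_diff_le:
  fixes u v x :: "'a::real_normed_vector"
  assumes "a \<in> {0..1::real}" "norm (u - x) \<le> c" "norm (v - x) \<le> c"
  shows "norm ((1 - a) *\<^sub>R u + a *\<^sub>R v - x) \<le> c"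
  using convexD_alt[OF convex_cball, of u x c v a] assms
  by (simp add: dist_norm norm_minus_commute)

theorem theorem1:
  fixes S :: "'a::banach set"
    and T :: "'a \<Rightarrow> 'a"
    and \<delta> :: real
    and \<alpha>1 \<alpha>2 \<alpha>3 :: "nat \<Rightarrow> real"
    and p q r :: "nat \<Rightarrow> 'a"
  assumes "S \<noteq> {}" and "closed S" and "convex S"
    and "T \<in> S \<rightarrow> S"
    and "0 < \<delta>" and "\<delta> < 1"
    and "\<And>x y. x \<in> S \<Longrightarrow> y \<in> S \<Longrightarrow> norm (T x - T y) \<le> \<delta> * norm (x - y)"
    and "\<And>n. \<alpha>1 n \<in> {0..1}"
    and "\<And>n. \<alpha>2 n \<in> {0..1}"
    and "\<And>n. \<alpha>3 n \<in> {0..1}"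
    and "filterlim (\<lambda>n. \<Sum>k\<le>n. \<alpha>1 k) at_top sequentially"
    and "p 0 \<in> S"
    and "\<And>n. r n = (1 - \<alpha>3 n) *\<^sub>R p n + \<alpha>3 n *\<^sub>R T (p n)"
    and "\<And>n. q n = (1 - \<alpha>2 n) *\<^sub>R T (p n) + \<alpha>2 n *\<^sub>R T (r n)"
    and "\<And>n. p (Suc n) = (1 - \<alpha>1 n) *\<^sub>R T (p n) + \<alpha>1 n *\<^sub>R T (q n)"
  shows "(\<exists>!x. x \<in> S \<and> T x = x) \<and>
         (\<forall>x. x \<in> S \<and> T x = x \<longrightarrow> p \<longlonglongrightarrow> x)"
proof (intro conjI allI impI)
  note T = assms(4) and contr = assms(7)
  have inS: "(1 - a) *\<^sub>R u + a *\<^sub>R v \<in> S" if "u \<in> S" "v \<in> S" "a \<in> {0..1}" for a u v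
    using convexD_alt[OF assms(3) that(1,2)] that(3) by simp
  \<comment> \<open>Banach's fixed point theorem applies because \<open>S\<close>, being closed in a
    Banach space, is complete.\<close>
  show "\<exists>!x. x \<in> S \<and> T x = x"
    by (rule Banach_fix[of S \<delta> T]) (use assms(1,2,5-7) T in \<open>auto simp: complete_eq_closed dist_norm\<close>)
  fix x assume x: "x \<in> S \<and> T x = x"
  have Tx: "norm (T y - x) \<le> \<delta> * norm (y - x)" if "y \<in> S" for y
    using contr[of y x] x that by simp
  \<comment> \<open>Used to give up a factor \<open>\<delta>\<close> wherever two points have to be
    put into the same ball.\<close>
  have shrink: "\<delta> * norm y \<le> norm y" for y :: 'a
    using assms(6) by (simp add: mult_left_le_one_le assms(5) less_imp_le)
  \<comment> \<open>Membership in \<open>S\<close> travels with the estimate, since \<open>T\<close>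
    is known to contract only on \<open>S\<close>.\<close>
  have step: "p (Suc n) \<in> S \<and> norm (p (Suc n) - x) \<le> \<delta> * norm (p n - x)" if p: "p n \<in> S" for n
  proof -
    have Tp: "T (p n) \<in> S" "norm (T (p n) - x) \<le> \<delta> * norm (p n - x)"
      using T p Tx by auto
    \<comment> \<open>No factor \<open>\<delta>\<close> here: \<open>p n\<close> itself enters the
      combination, so the common radius is \<open>norm (p n - x)\<close>.\<close>
    have r: "r n \<in> S" "norm (r n - x) \<le> norm (p n - x)"
      unfolding assms(13)
      using inS[OF p Tp(1) assms(10)]
        norm_convex_combination_diff_le[OF assms(10) order_refl order_trans[OF Tp(2) shrink]]
      by auto
    \<comment> \<open>Applying \<open>T\<close> supplies the factor \<open>\<delta>\<close> that the
      bound on \<open>r n\<close> lacks.\<close>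
    have Tr: "T (r n) \<in> S" "norm (T (r n) - x) \<le> \<delta> * norm (p n - x)"
      using T r(1) order_trans[OF Tx[OF r(1)] mult_left_mono[OF r(2)]] assms(5) by auto
    have q: "q n \<in> S" "norm (q n - x) \<le> \<delta> * norm (p n - x)"
      unfolding assms(14)
      using inS[OF Tp(1) Tr(1) assms(9)]
        norm_convex_combination_diff_le[OF assms(9) Tp(2) Tr(2)]
      by auto
    \<comment> \<open>The contraction would give \<open>\<delta>\<close>^2; one factor is dropped to
      match the radius available for \<open>T (p n)\<close>.\<close>
    have Tq: "T (q n) \<in> S" "norm (T (q n) - x) \<le> \<delta> * norm (p n - x)"
      using T q(1) order_trans[OF order_trans[OF Tx[OF q(1)] shrink] q(2)] by auto
    show ?thesis
      unfolding assms(15)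
      using inS[OF Tp(1) Tq(1) assms(8)]
        norm_convex_combination_diff_le[OF assms(8) Tp(2) Tq(2)]
      by blast
  qed
  have bound: "p n \<in> S \<and> norm (p n - x) \<le> \<delta> ^ n * norm (p 0 - x)" for n
  proof (induction n)
    case 0
    show ?case using assms(12) by simp
  next
    case (Suc n)
    then have "\<delta> * norm (p n - x) \<le> \<delta> * (\<delta> ^ n * norm (p 0 - x))"
      using assms(5) by (intro mult_left_mono) auto
    with step[of n] Suc show ?case by (auto simp: mult.assoc)
  qed
  have "(\<lambda>n. \<delta> ^ n * norm (p 0 - x)) \<longlonglongrightarrow> 0"
    using assms(5,6) by (intro tendsto_mult_left_zero LIMSEQ_power_zero) auto
  \<comment> \<open>Comparison with the geometric null sequence that dominates the norms.\<close>
  then have "(\<lambda>n. p n - x) \<longlonglongrightarrow> 0"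
    by (rule Lim_null_comparison[rotated]) (use bound in auto)
  then show "p \<longlonglongrightarrow> x"
    by (rule LIM_zero_cancel)
qed

end
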